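(* Let $m \in \mathbb{Z}_{\ge 1}$. For every position $P=(n_1,\dots,n_m)\in\mathbb{N}^m$ of the game CDN$_m$ (Common Divisor Nim), the Sprague-Grundy value of $P$ is \[ \mathrm{sg}(P) = \begin{cases} \lambda(P)+1 & \text{if } P\neq\mathbf{0} \text{ and } \iota(P) \text{ is an odd number},\\ 0 & \text{if } P\neq\mathbf{0} \text{ and } \iota(P) \text{ is an even number, or if } P=\mathbf{0}. \end{cases} \]
   Context: $\mathbb{N}$ denotes the set of all nonnegative integers, and $\mathbf{0}:=(0,\dots,0)\in\mathbb{N}^m$. The game CDN$_m$ (Common Divisor Nim) is played by two players alternately. Its set of positions is $\mathbb{N}^m$. For a position $P=(n_1,\dots,n_m)\in\mathbb{N}^m$, the set $N(P)$ of next positions to $P$ is the set of all $(n'_1,\dots,n'_m)\in\mathbb{N}^m$ for which there is an integer $1\le i\le m$ such that $n'_j=n_j$ for all $1\le j\le m$ with $j\ne i$, and $n_i-n'_i$ is a positive common divisor of $n_1,\dots,n_m$ (every positive integer divides $0$). The position $\mathbf{0}$ is the unique end position. For a finite subset $T\subset\mathbb{N}$, $\mathrm{mex}(T):=\min(\mathbb{N}\setminus T)$. The Sprague-Grundy value is defined recursively by $\mathrm{sg}(P):=\mathrm{mex}\{\mathrm{sg}(P')\mid P'\in N(P)\}$. For $a\in\mathbb{N}$, $\mathrm{ord}_2(a):=\max\{L\in\mathbb{N}\mid 2^L \text{ is a divisor of } a\}$ if $a\ne 0$, and $\mathrm{ord}_2(0):=+\infty$, where $+\infty$ is a formal element larger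 than every element of $\mathbb{N}$. For $P=(n_1,\dots,n_m)\in\mathbb{N}^m$, set \[ \lambda(P):=\min\{\mathrm{ord}_2(n_i)\mid 1\le i\le m\},\qquad \iota(P):=\#\{1\le i\le m\mid \mathrm{ord}_2(n_i)=\lambda(P)\}. \] *)

theory Defs
  imports
    "HOL-Analysis.Finite_Cartesian_Product"
    "HOL-Computational_Algebra.Primes"
    "HOL-Library.Extended_Nat"
begin

text \<open>
  The positions of Common Divisor Nim with $m \geq 1$ components are the elements of
  \<^typ>\<open>nat ^ 'm\<close>, with $m$ the cardinality of the finite, nonempty index type \<open>'m\<close>.
  Below, the condition \<open>Q $ i < P $ i\<close> ensures that the truncated difference is the integer one
  and positive.
\<close>

definition next_positions :: "nat ^ 'm \<Rightarrow> (nat ^ 'm) set" where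
  "next_positions P =
     {Q. \<exists>i. (\<forall>j. j \<noteq> i \<longrightarrow> Q $ j = P $ j) \<and>
             Q $ i < P $ i \<and> (\<forall>j. (P $ i - Q $ i) dvd P $ j)}"

lemma sum_less_if_next_position:
  fixes P Q :: "nat ^ 'm"
  assumes "Q \<in> next_positions P"
  shows "(\<Sum>i\<in>UNIV. Q $ i) < (\<Sum>i\<in>UNIV. P $ i)"
proof -
  from assms obtain i where i: "\<forall>j. j \<noteq> i \<longrightarrow> Q $ j = P $ j" "Q $ i < P $ i"
    unfolding next_positions_def by blast
  have "Q $ j \<le> P $ j" for j
    using i by (cases "j = i") auto
  then show ?thesis
    using i(2) by (intro sum_strict_mono_ex1) auto
qed

lemma finite_next_positions: "finite (next_positions P)" for P :: "nat ^ 'm"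
proof -
  have "next_positions P \<subseteq> (\<lambda>(i, n). \<chi> j. if j = i then n else P $ j) ` (SIGMA i:UNIV. {..<P $ i})"
  proof
    fix Q assume "Q \<in> next_positions P"
    then obtain i where i: "\<forall>j. j \<noteq> i \<longrightarrow> Q $ j = P $ j" "Q $ i < P $ i"
      unfolding next_positions_def by blast
    then have "Q = (\<chi> j. if j = i then Q $ i else P $ j)"
      by (simp add: vec_eq_iff)
    with i(2) show "Q \<in> (\<lambda>(i, n). \<chi> j. if j = i then n else P $ j) ` (SIGMA i:UNIV. {..<P $ i})"
      by (intro image_eqI[where x = "(i, Q $ i)"]) auto
  qed
  then show ?thesis
    by (rule finite_subset) auto
qed

lemma next_positions_eq_empty_iff: "next_positions P = {} \<longleftrightarrow> P = 0" for P :: "nat ^ 'm"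
proof
  assume empty: "next_positions P = {}"
  show "P = 0"
  proof (rule ccontr)
    assume "P \<noteq> 0"
    then obtain i where i: "P $ i > 0"
      by (auto simp: vec_eq_iff)
    have "(\<chi> j. if j = i then P $ i - 1 else P $ j) \<in> next_positions P"
      unfolding next_positions_def using i by (auto intro!: exI[of _ i])
    with empty show False
      by simp
  qed
qed (simp add: next_positions_def)

definition mex :: "nat set \<Rightarrow> nat" where
  "mex T = (LEAST n. n \<notin> T)"

function sg :: "nat ^ 'm \<Rightarrow> nat" where
  "sg P = mex (sg ` next_positions P)"
  by auto
termination
  by (relation "measure (\<lambda>P. \<Sum>i\<in>UNIV. P $ i)") (simp_all add: sum_less_if_next_position)

declare sg.simps [simp del]

text \<open>
  On nonzero numbers, \<open>multiplicity 2 a\<close> is by definition the largest $L$ such that $2^L$ divides $a$;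
  its library value at 0 is 0, hence the case distinction.
\<close>

definition ord2 :: "nat \<Rightarrow> enat" where
  "ord2 a = (if a = 0 then \<infinity> else enat (multiplicity 2 a))"

text \<open>\<open>min_ord2 P\<close> and \<open>count_min_ord2 P\<close> are $\lambda(P)$ and $\iota(P)$.\<close>

definition min_ord2 :: "nat ^ 'm \<Rightarrow> enat" where
  "min_ord2 P = Min (range (\<lambda>i. ord2 (P $ i)))"

definition count_min_ord2 :: "nat ^ 'm \<Rightarrow> nat" where
  "count_min_ord2 P = card {i. ord2 (P $ i) = min_ord2 P}"

end

theory Submission
  imports Defs
begin

text \<open>
  Attach to a position $P$ and a number $L$ the statement \<open>odd_order L P\<close>: $2^L$ divides all
  components and $2^{L+1}$ fails to divide an odd number of them. It can hold for at most one $L$,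
  namely $\lambda(P)$, and it then says that $\iota(P)$ is odd. So the claim is that the
  Sprague-Grundy value is $L+1$ if \<open>odd_order L P\<close> holds, and 0 if there is no such $L$.

  The key observation (\<open>odd_order_subtract_iff\<close>) is a parity flip: if a move subtracts $d$ from
  component $i$ and $e$ is the order of $d$ at 2, then $2^e$ divides all components before
  and after the move, and the set of components not divisible by $2^{e+1}$ changes exactly at $i$.
  Hence exactly one of the two positions satisfies \<open>odd_order e\<close>. This shows at once that no move
  preserves the claimed value. It also shows that subtracting $2^e$ with $e < \lambda(P)$ reaches the
  value $e + 1$. What remains is to reach the value 0 from a position with \<open>odd_order L\<close>
  (\<open>ex_next_position_without_odd_order\<close>): subtracting $2^L$ makes the number of components of order
  $L$ even, and it suffices to keep that number positive, which is possible unless only one component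
  is nonzero, in which case the move to the end position does it.
\<close>

section \<open>Parity of the number of components of least order\<close>

text \<open>
  The name refers to positions all of whose components are divisible by $2^L$: only there are these
  the components of order exactly $L$.
\<close>

definition exact_order :: "nat \<Rightarrow> nat ^ 'm \<Rightarrow> 'm set" where
  "exact_order L P = {i. \<not> 2 ^ Suc L dvd P $ i}"

definition odd_order :: "nat \<Rightarrow> nat ^ 'm \<Rightarrow> bool" where
  "odd_order L P \<longleftrightarrow> (\<forall>i. 2 ^ L dvd P $ i) \<and> odd (card (exact_order L P))"

lemma not_power_dvd_larger_exponent:
  fixes a :: nat
  assumes "\<not> 2 ^ Suc k dvd a" "k < l"
  shows "\<not> 2 ^ l dvd a"
  using assms by (meson Suc_leI dvd_trans le_imp_power_dvd)

lemma exact_order_determines_exponent: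
  assumes "\<forall>i. 2 ^ K dvd P $ i" "\<forall>i. 2 ^ L dvd P $ i"
    and "exact_order K P \<noteq> {}" "exact_order L P \<noteq> {}"
  shows "K = L"
proof -
  from assms obtain i j where "\<not> 2 ^ Suc K dvd P $ i" "\<not> 2 ^ Suc L dvd P $ j"
    unfolding exact_order_def by blast
  with assms(1,2) have "\<not> K < L" "\<not> L < K"
    using not_power_dvd_larger_exponent by blast+
  then show ?thesis
    by simp
qed

lemma odd_order_imp_exact_order_nonempty: "odd_order L P \<Longrightarrow> exact_order L P \<noteq> {}"
  by (auto simp: odd_order_def)

lemma odd_order_unique: "odd_order K P \<Longrightarrow> odd_order L P \<Longrightarrow> K = L"
  using exact_order_determines_exponent odd_order_imp_exact_order_nonempty
  unfolding odd_order_def by metis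

section \<open>The parity flip caused by a move\<close>

definition subtract_at :: "'m \<Rightarrow> nat \<Rightarrow> nat ^ 'm \<Rightarrow> nat ^ 'm" where
  "subtract_at i d P = (\<chi> j. if j = i then P $ i - d else P $ j)"

lemma subtract_at_nth [simp]:
  "subtract_at i d P $ j = (if j = i then P $ i - d else P $ j)"
  by (simp add: subtract_at_def)

lemma subtract_at_in_next_positions:
  assumes "0 < d" "d \<le> P $ i" "\<And>j. d dvd P $ j"
  shows "subtract_at i d P \<in> next_positions P"
  using assms by (auto simp: next_positions_def intro!: exI[of _ i])

lemma next_positionsE:
  assumes "Q \<in> next_positions P"
  obtains i d where "0 < d" "d \<le> P $ i" "\<And>j. d dvd P $ j" "Q = subtract_at i d P"
proof -
  from assms obtain i where i: "\<forall>j. j \<noteq> i \<longrightarrow> Q $ j = P $ j" "Q $ i < P $ i"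
    "\<forall>j. (P $ i - Q $ i) dvd P $ j"
    unfolding next_positions_def by blast
  then have "Q = subtract_at i (P $ i - Q $ i) P"
    by (simp add: vec_eq_iff)
  with i show thesis
    by (intro that[of "P $ i - Q $ i" i]) auto
qed

text \<open>
  Dividing by $2^e$ turns this into the fact that subtracting an odd number changes the parity.
\<close>

lemma power_Suc_dvd_diff_iff:
  fixes a d :: nat
  assumes "2 ^ e dvd a" "2 ^ e dvd d" "\<not> 2 ^ Suc e dvd d" "d \<le> a"
  shows "2 ^ Suc e dvd a - d \<longleftrightarrow> \<not> 2 ^ Suc e dvd a"
proof -
  from assms obtain a' d' where a': "a = 2 ^ e * a'" and d': "d = 2 ^ e * d'"
    unfolding dvd_def by blast
  have reduce: "2 ^ Suc e dvd 2 ^ e * c \<longleftrightarrow> even c" for c :: nat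
    by (simp add: mult.commute[of 2])
  have "odd d'"
    using assms(3) unfolding d' reduce .
  moreover have "d' \<le> a'"
    using assms(4) unfolding a' d' by simp
  moreover have "a - d = 2 ^ e * (a' - d')"
    unfolding a' d' by (simp add: diff_mult_distrib2)
  ultimately show ?thesis
    unfolding a' by (simp only: reduce) (simp only: even_diff_nat, auto)
qed

lemma exact_order_subtract:
  fixes P :: "nat ^ 'm"
  assumes "d \<le> P $ i" "\<And>j. d dvd P $ j" "2 ^ e dvd d" "\<not> 2 ^ Suc e dvd d"
  shows "\<forall>j. 2 ^ e dvd P $ j"
    and "\<forall>j. 2 ^ e dvd subtract_at i d P $ j"
    and "exact_order e (subtract_at i d P) =
           (if i \<in> exact_order e P then exact_order e P - {i} else insert i (exact_order e P))"
proof -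
  show P: "\<forall>j. 2 ^ e dvd P $ j"
    using assms dvd_trans by blast
  then show "\<forall>j. 2 ^ e dvd subtract_at i d P $ j"
    using assms(3) by (simp add: dvd_diff_nat)
  have "2 ^ Suc e dvd P $ i - d \<longleftrightarrow> \<not> 2 ^ Suc e dvd P $ i"
    using P assms by (intro power_Suc_dvd_diff_iff) auto
  then show "exact_order e (subtract_at i d P) =
      (if i \<in> exact_order e P then exact_order e P - {i} else insert i (exact_order e P))"
    unfolding exact_order_def by (auto simp del: power_Suc split: if_splits)
qed

text \<open>
  The set of components of order $e$ gains or loses the single element $i$, so its cardinality changes
  parity.
\<close>

lemma odd_order_subtract_iff:
  fixes P :: "nat ^ 'm"
  assumes "d \<le> P $ i" "\<And>j. d dvd P $ j" "2 ^ e dvd d" "\<not> 2 ^ Suc e dvd d"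
  shows "odd_order e (subtract_at i d P) \<longleftrightarrow> \<not> odd_order e P"
proof -
  note subtract = exact_order_subtract[where P = P and i = i, OF assms]
  have "odd (card (exact_order e (subtract_at i d P))) \<longleftrightarrow> even (card (exact_order e P))"
  proof (cases "i \<in> exact_order e P")
    case True
    then have "card (exact_order e P) = Suc (card (exact_order e P - {i}))"
      by (intro card.remove) auto
    with True show ?thesis
      unfolding subtract(3) by (simp del: card_Diff_insert card_Diff_singleton)
  next
    case False
    then show ?thesis
      by (simp add: subtract(3))
  qed
  with subtract(1,2) show ?thesis
    by (auto simp: odd_order_def)
qed

lemma not_power_Suc_dvd_power: "\<not> (2::nat) ^ Suc e dvd 2 ^ e"
  by (simp add: power_dvd_imp_le)

text \<open>
  The exponent $e$ is the order at 2 of the number subtracted. As \<open>odd_order\<close> holds for at most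
  one exponent, two positions with the same claimed value satisfy \<open>odd_order\<close> for the same
  exponents, so a move cannot lead from one to the other.
\<close>

lemma odd_order_flips_in_next_position:
  fixes P :: "nat ^ 'm"
  assumes "Q \<in> next_positions P"
  obtains e where "odd_order e Q \<longleftrightarrow> \<not> odd_order e P"
proof -
  from assms obtain i d where d: "0 < d" "d \<le> P $ i" "\<And>j. d dvd P $ j" "Q = subtract_at i d P"
    using next_positionsE by blast
  have "\<not> 2 ^ Suc (multiplicity 2 d) dvd d"
    using d(1) by (subst power_dvd_iff_le_multiplicity) auto
  then show thesis
    using odd_order_subtract_iff[OF d(2,3)] d(4) that multiplicity_dvd by blast
qed

section \<open>Reaching all smaller values\<close>

lemma power_subtract_in_next_positions:
  assumes "\<forall>j. 2 ^ e dvd P $ j" "P $ i \<noteq> 0"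
  shows "subtract_at i (2 ^ e) P \<in> next_positions P"
  using assms by (intro subtract_at_in_next_positions) (auto intro: dvd_imp_le)

text \<open>
  By uniqueness \<open>odd_order e\<close> fails at $P$, so subtracting $2^e$ from any nonzero component makes
  it true.
\<close>

lemma ex_next_position_odd_order_smaller:
  fixes P :: "nat ^ 'm"
  assumes "odd_order L P" "e < L"
  obtains Q where "Q \<in> next_positions P" "odd_order e Q"
proof -
  obtain i where i: "P $ i \<noteq> 0"
    using odd_order_imp_exact_order_nonempty[OF assms(1)] unfolding exact_order_def by fastforce
  have dvd: "\<forall>j. 2 ^ e dvd P $ j"
    using assms by (meson dvd_trans le_imp_power_dvd less_imp_le odd_order_def)
  have "\<not> odd_order e P"
    using assms odd_order_unique by blast
  then have "odd_order e (subtract_at i (2 ^ e) P)"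
    using dvd i not_power_Suc_dvd_power by (subst odd_order_subtract_iff) (auto intro: dvd_imp_le)
  with power_subtract_in_next_positions[OF dvd i] show thesis
    by (rule that)
qed

text \<open>
  This provides the moves to value 0. Which component to subtract from depends on how many have order
  $L$. If several do, subtract from one of them. If only one does, subtract from another nonzero
  component, which then gets order $L$ as well. If there is no other nonzero component, take the whole
  of the only one.
\<close>

lemma ex_next_position_without_odd_order:
  fixes P :: "nat ^ 'm"
  assumes "odd_order L P"
  shows "\<exists>Q \<in> next_positions P. \<forall>K. \<not> odd_order K Q"
proof -
  have dvd: "\<forall>j. 2 ^ L dvd P $ j"
    using assms by (simp add: odd_order_def)
  \<comment> \<open>Subtracting $2^L$ destroys \<open>odd_order L\<close>; no other exponent can take over as long as some
    component of order $L$ remains.\<close>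
  have even_move: ?thesis
    if j: "P $ j \<noteq> 0" and nonempty: "exact_order L (subtract_at j (2 ^ L) P) \<noteq> {}" for j
  proof -
    let ?Q = "subtract_at j (2 ^ L) P"
    have next_position: "?Q \<in> next_positions P"
      using dvd j by (rule power_subtract_in_next_positions)
    have le: "2 ^ L \<le> P $ j"
      using dvd j by (auto intro: dvd_imp_le)
    have "\<not> odd_order L ?Q"
      using assms le dvd not_power_Suc_dvd_power by (subst odd_order_subtract_iff) auto
    moreover have "\<forall>k. 2 ^ L dvd ?Q $ k"
      using le dvd not_power_Suc_dvd_power by (intro exact_order_subtract(2)) auto
    ultimately have "\<not> odd_order K ?Q" for K
      using nonempty exact_order_determines_exponent[of K ?Q L]
        odd_order_imp_exact_order_nonempty[of K ?Q] unfolding odd_order_def by metis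
    with next_position show ?thesis
      by blast
  qed
  obtain i where i: "i \<in> exact_order L P"
    using odd_order_imp_exact_order_nonempty[OF assms] by blast
  then have i_nonzero: "P $ i \<noteq> 0"
    unfolding exact_order_def by (metis (mono_tags) dvd_0_right mem_Collect_eq)
  have remains: "k \<in> exact_order L (subtract_at j (2 ^ L) P)"
    if "k \<in> exact_order L P" "k \<noteq> j" for j k
    using that by (simp add: exact_order_def)
  show ?thesis
  proof (cases "exact_order L P = {i}")
    case False
    then obtain k where "k \<in> exact_order L P" "k \<noteq> i"
      using i by blast
    with remains[of k i] i_nonzero show ?thesis
      by (intro even_move[of i]) auto
  next
    case True
    show ?thesis
    proof (cases "\<exists>j. j \<noteq> i \<and> P $ j \<noteq> 0")
      case True
      then obtain j where "j \<noteq> i" "P $ j \<noteq> 0"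
        by blast
      with remains[OF i, of j] show ?thesis
        by (intro even_move[of j]) auto
    next
      case False
      then have zero: "subtract_at i (P $ i) P = 0"
        by (auto simp: vec_eq_iff)
      have "P $ i dvd P $ j" for j
        using False by (cases "j = i") auto
      then have "0 \<in> next_positions P"
        using subtract_at_in_next_positions[of "P $ i" P i] i_nonzero zero by simp
      moreover have "\<not> odd_order K 0" for K
        by (simp add: odd_order_def exact_order_def)
      ultimately show ?thesis
        by blast
    qed
  qed
qed

section \<open>The Sprague-Grundy values\<close>

lemma mex_eqI:
  assumes "n \<notin> T" "\<And>k. k < n \<Longrightarrow> k \<in> T"
  shows "mex T = n"
  unfolding mex_def using assms by (intro Least_equality) (auto simp: not_less[symmetric])

text \<open>
  Quantified over all $L$, the equivalence also describes the positions of value 0, as those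
  satisfying \<open>odd_order L\<close> for no $L$. It is in this form that the induction hypothesis is used.
\<close>

lemma sg_eq_Suc_iff_odd_order: "sg P = Suc L \<longleftrightarrow> odd_order L P"
proof (induction P arbitrary: L rule: sg.induct)
  case (1 P)
  show ?case
  proof (cases "\<exists>M. odd_order M P")
    case True
    then obtain M where M: "odd_order M P" ..
    have "sg P = Suc M"
      unfolding sg.simps[of P]
    proof (rule mex_eqI)
      show "Suc M \<notin> sg ` next_positions P"
      proof
        assume "Suc M \<in> sg ` next_positions P"
        then obtain Q where Q: "Q \<in> next_positions P" "odd_order M Q"
          using 1 by fastforce
        from Q(1) obtain e where "odd_order e Q \<longleftrightarrow> \<not> odd_order e P"
          by (rule odd_order_flips_in_next_position)
        with M Q(2) show False
          using odd_order_unique by blast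
      qed
    next
      fix k
      assume "k < Suc M"
      show "k \<in> sg ` next_positions P"
      proof (cases k)
        case 0
        obtain Q where Q: "Q \<in> next_positions P" "\<forall>K. \<not> odd_order K Q"
          using ex_next_position_without_odd_order[OF M] by blast
        then have "sg Q = 0"
          using 1 not0_implies_Suc by blast
        with Q(1) 0 show ?thesis
          by (metis image_eqI)
      next
        case (Suc e)
        with \<open>k < Suc M\<close> obtain Q where "Q \<in> next_positions P" "odd_order e Q"
          using ex_next_position_odd_order_smaller[OF M] by auto
        with 1 Suc show ?thesis
          by (metis image_eqI)
      qed
    qed
    with M show ?thesis
      using odd_order_unique by auto
  next
    case False
    have "sg Q \<noteq> 0" if Q: "Q \<in> next_positions P" for Q
    proof -
      obtain e where "odd_order e Q"
        using odd_order_flips_in_next_position[OF Q] False by metis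
      with 1 Q show ?thesis
        by fastforce
    qed
    then have "sg P = 0"
      unfolding sg.simps[of P] by (intro mex_eqI) fastforce+
    with False show ?thesis
      by simp
  qed
qed

lemma enat_le_ord2_iff: "enat L \<le> ord2 a \<longleftrightarrow> 2 ^ L dvd a"
  by (auto simp: ord2_def power_dvd_iff_le_multiplicity)

lemma odd_order_iff:
  fixes P :: "nat ^ 'm"
  shows "odd_order L P \<longleftrightarrow> min_ord2 P = enat L \<and> odd (count_min_ord2 P)"
proof -
  have le_min: "enat K \<le> min_ord2 P \<longleftrightarrow> (\<forall>i. 2 ^ K dvd P $ i)" for K
    unfolding min_ord2_def by (subst Min_ge_iff) (auto simp: enat_le_ord2_iff)
  have exact_order_eq: "exact_order L P = {i. ord2 (P $ i) = enat L}" if "\<forall>i. 2 ^ L dvd P $ i"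
  proof -
    have "\<not> enat (Suc L) \<le> x \<longleftrightarrow> x = enat L" if "enat L \<le> x" for x
      using that by (cases x) auto
    with that show ?thesis
      unfolding exact_order_def enat_le_ord2_iff[symmetric] by blast
  qed
  show ?thesis
  proof
    assume L: "odd_order L P"
    then have dvd: "\<forall>i. 2 ^ L dvd P $ i"
      by (simp add: odd_order_def)
    obtain i where "ord2 (P $ i) = enat L"
      using odd_order_imp_exact_order_nonempty[OF L] exact_order_eq[OF dvd] by blast
    then have "min_ord2 P \<le> enat L"
      unfolding min_ord2_def by (metis Min_le finite finite_imageI rangeI)
    with le_min dvd have "min_ord2 P = enat L"
      by (simp add: order_antisym)
    with L exact_order_eq[OF dvd] show "min_ord2 P = enat L \<and> odd (count_min_ord2 P)"
      by (simp add: odd_order_def count_min_ord2_def)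
  next
    assume R: "min_ord2 P = enat L \<and> odd (count_min_ord2 P)"
    then have dvd: "\<forall>i. 2 ^ L dvd P $ i"
      using le_min[of L] by simp
    with R exact_order_eq[OF dvd] show "odd_order L P"
      by (auto simp: odd_order_def count_min_ord2_def)
  qed
qed

lemma min_ord2_infinity_iff:
  fixes P :: "nat ^ 'm"
  shows "min_ord2 P = \<infinity> \<longleftrightarrow> P = 0"
proof
  assume "min_ord2 P = \<infinity>"
  moreover have "min_ord2 P \<le> ord2 (P $ i)" for i
    unfolding min_ord2_def by (intro Min_le) auto
  ultimately have "ord2 (P $ i) = \<infinity>" for i
    by (metis enat_ord_simps(5))
  then have "P $ i = 0" for i
    by (metis ord2_def enat.distinct(1))
  then show "P = 0"
    by (simp add: vec_eq_iff)
qed (simp add: min_ord2_def ord2_def)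

theorem theorem1p3:
  fixes P :: "nat ^ 'm"
  shows "enat (sg P) =
           (if P \<noteq> 0 \<and> odd (count_min_ord2 P) then min_ord2 P + 1 else 0)"
proof (cases "P \<noteq> 0 \<and> odd (count_min_ord2 P)")
  case True
  then obtain L where L: "min_ord2 P = enat L"
    using min_ord2_infinity_iff by blast
  with True have "sg P = Suc L"
    by (simp add: sg_eq_Suc_iff_odd_order odd_order_iff)
  with True L show ?thesis
    by (simp add: one_enat_def)
next
  case False
  then have "\<not> odd_order L P" for L
    using min_ord2_infinity_iff[of P] by (auto simp: odd_order_iff)
  then have "sg P = 0"
    using sg_eq_Suc_iff_odd_order not0_implies_Suc by blast
  with False show ?thesis
    by (auto simp: zero_enat_def)
qed

end
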